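(* Let $P=\prod_{i=1}^nP_{m_i}$ be a product of polygons, and let $\lambda$ be a factor-compatible characteristic matrix on $P$ (with the regrouping of square factors already carried out, so that $\chi_i\in\operatorname{row}(\lambda)$ for every $i$). Then, after permuting the polygon factors, $\lambda$ is Davis--Januszkiewicz equivalent to a block lower triangular characteristic matrix $$\lambda'=\begin{pmatrix}\Lambda_{11}&0&\cdots&0\\ \Lambda_{21}&\Lambda_{22}&\cdots&0\\ \vdots&\vdots&\ddots&\vdots\\ \Lambda_{n1}&\Lambda_{n2}&\cdots&\Lambda_{nn}\end{pmatrix},$$ where $\Lambda_{ij}$ is a $2\times m_j$ matrix over $\mathbb Z_2$ (rows divided into $n$ blocks of size $2$, columns divided according to the polygon factors) and each $\Lambda_{ii}$ is a characteristic matrix on $P_{m_i}$. Moreover, the first row of each $\Lambda_{ii}$ may be chosen to be the all-one vector.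
   Context: Conventions. $\mathbb Z_2=\mathbb Z/2\mathbb Z$. $P_k$ denotes the polygon with $k\ge 3$ sides. $P=P_{m_1}\times\cdots\times P_{m_n}$ is a simple polytope of dimension $2n$ with $m=m_1+\cdots+m_n$ facets. If $E_{i,1},\dots,E_{i,m_i}$ are the sides of $P_{m_i}$ in cyclic order (second index modulo $m_i$), the facets of $P$ are $F_{i,j}=P_{m_1}\times\cdots\times P_{m_{i-1}}\times E_{i,j}\times P_{m_{i+1}}\times\cdots\times P_{m_n}$. The standard basis of $\mathbb Z_2^m$ is indexed by the facets, and $F_{i,j}$ also denotes the corresponding basis vector. Small covers. The real moment-angle manifold of a simple polytope $P$ with $m$ facets $F_1,\dots,F_m$ is $\mathbb R\mathcal Z_P=(\mathbb Z_2^m\times P)/\sim$, where $(g,p)\sim(h,p)$ iff $g+h$ lies in the span of the basis vectors $e_i$ of the facets $F_i$ containing $p$; $\mathbb Z_2^m$ acts by $h\cdot[g,p]=[h+g,p]$. A mod 2 characteristic map (matrix) over $P$ (with $\dim P=d$) is a linear map $\lambda:\mathbb Z_2^m\to\mathbb Z_2^d$, identified with its $d\times m$ matrix, such that whenever $F_{i_1}\cap\cdots\cap F_{i_k}\ne\varnothing$, the vectors $\lambda(e_{i_1}),\dots,\lambda(e_{i_k})$ are linearly independent. In particular, a $2\times m_i$ matrix is a characteristic matrix on $P_{m_i}$ iff any two columns corresponding to adjacent sides form a basis of $\mathbb Z_2^2$. $G=\ker\lambda$ acts freely on $\mathbb R\mathcal Z_P$, and the small cover is $M(P,\lambda)=\mathbb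 R\mathcal Z_P/G$, with action of $\mathbb Z_2^d\cong\mathbb Z_2^m/G$ and orbit space $P$. $\operatorname{row}(\lambda)\subset\mathbb Z_2^m$ is the row space of $\lambda$. Two small covers $M(P,\lambda)$, $M(P,\lambda')$ over the same $P$ (or the matrices $\lambda,\lambda'$) are Davis--Januszkiewicz equivalent if there is a weakly $\mathbb Z_2^d$-equivariant homeomorphism (equivariant up to an automorphism of $\mathbb Z_2^d$) between them covering the identity map of $P$. In particular, matrices differing by elementary row operations are Davis--Januszkiewicz equivalent. Factor-compatibility. Put $\chi_i=F_{i,1}+\cdots+F_{i,m_i}\in\mathbb Z_2^m$. Let $i_1,\dots,i_r$ be the indices with $m_i=4$, and put $\delta_a^+=F_{i_a,1}+F_{i_a,3}$, $\delta_a^-=F_{i_a,2}+F_{i_a,4}$ for $a=1,\dots,r$; these correspond to the $2r$ interval directions of the cube part $\prod_{m_i=4}P_4\cong(\Delta^1)^{2r}$. $\lambda$ (or $M(P,\lambda)$) is factor-compatible if, after permuting the interval directions of the cube part and regrouping them into $r$ square factors, the total facet weight (sum of the basis vectors of all facets coming from the factor) of every resulting polygon factor lies in $\operatorname{row}(\lambda)$. Explicitly: $\chi_i\in\operatorname{row}(\lambda)$ whenever $m_i\ne4$, and the weights $\delta_1^\pm,\dots,\delta_r^\pm$ can be partitioned into $r$ pairs $\{\omega_\ell,\omega_\ell'\}$ with $\omega_\ell+\omega'_\ell\in\operatorname{row}(\lambda)$ for all $\ell$; the two opposite pairs of facets recorded by $\omega_\ell,\omega'_\ell$ then form the two interval directions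 of the $\ell$th new square factor. By convention, such a regrouping is fixed once and for all, $P$ is replaced by the regrouped product (again written $\prod_iP_{m_i}$) and facets are relabelled, so that $\chi_i\in\operatorname{row}(\lambda)$ for all $i$. *)

theory Defs
  imports
    "HOL-Analysis.Function_Topology"
    "HOL-Analysis.Product_Topology"
    "HOL-Analysis.Line_Segment"
    "HOL-Library.Z2"
    "HOL-Library.Disjoint_Sets"
    "Jordan_Normal_Form.VS_Connect"
    "Jordan_Normal_Form.Matrix_Kernel"
begin

text \<open>
  The field with two elements is the type \<^typ>\<open>bit\<close>.  Everything is indexed from \<open>0\<close>.
\<close>

section \<open>Linear algebra over the field with two elements\<close>

abbreviation span2 :: "nat \<Rightarrow> bit vec set \<Rightarrow> bit vec set" where
  "span2 d \<equiv> LinearCombinations.module.span class_ring (module_vec TYPE(bit) d)"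

abbreviation lin_indpt2 :: "nat \<Rightarrow> bit vec set \<Rightarrow> bool" where
  "lin_indpt2 d S \<equiv> \<not> LinearCombinations.module.lin_dep class_ring (module_vec TYPE(bit) d) S"

definition lin_indpt_family :: "nat \<Rightarrow> ('i \<Rightarrow> bit vec) \<Rightarrow> 'i set \<Rightarrow> bool" where
  "lin_indpt_family d v S \<longleftrightarrow> inj_on v S \<and> lin_indpt2 d (v ` S)"

abbreviation row_sp :: "bit mat \<Rightarrow> bit vec set" where
  "row_sp L \<equiv> vec_space.row_space (dim_col L) L"

section \<open>Characteristic matrices and small covers over a polytope\<close>

text \<open>
  A polytope enters only through its underlying space \<open>X\<close>, the number \<open>N\<close> of its facets,
  and its facets \<open>F l\<close> for \<open>l < N\<close>.  A characteristic map is identified with its matrix;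
  column \<open>l\<close> is the value at the basis vector of the facet \<open>F l\<close>.
\<close>

definition characteristic_matrix :: "nat \<Rightarrow> nat \<Rightarrow> (nat \<Rightarrow> 'p set) \<Rightarrow> bit mat \<Rightarrow> bool" where
  "characteristic_matrix d N F L \<longleftrightarrow>
     L \<in> carrier_mat d N \<and>
     (\<forall>S \<subseteq> {..<N}. (\<Inter>l\<in>S. F l) \<noteq> {} \<longrightarrow> lin_indpt_family d (col L) S)"

text \<open>The quotient of \<open>X\<close> by the equivalence relation having the same value under \<open>q\<close>.\<close>

definition quotient_space :: "'a topology \<Rightarrow> ('a \<Rightarrow> 'b) \<Rightarrow> 'b topology" where
  "quotient_space X q =
     topology (\<lambda>U. U \<subseteq> q ` topspace X \<and> openin X {x \<in> topspace X. q x \<in> U})"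

lemma openin_quotient_space:
  "openin (quotient_space X q) U \<longleftrightarrow>
     U \<subseteq> q ` topspace X \<and> openin X {x \<in> topspace X. q x \<in> U}"
proof -
  let ?L = "\<lambda>U. U \<subseteq> q ` topspace X \<and> openin X {x \<in> topspace X. q x \<in> U}"
  have "istopology ?L"
    unfolding istopology_def
  proof (intro conjI allI impI)
    fix S T assume "?L S" "?L T"
    moreover have "{x \<in> topspace X. q x \<in> S \<inter> T} =
        {x \<in> topspace X. q x \<in> S} \<inter> {x \<in> topspace X. q x \<in> T}" by auto
    ultimately show "S \<inter> T \<subseteq> q ` topspace X" "openin X {x \<in> topspace X. q x \<in> S \<inter> T}"
      by (auto intro: openin_Int)
  next
    fix K assume K: "\<forall>S\<in>K. ?L S"
    have "{x \<in> topspace X. q x \<in> \<Union>K} = (\<Union>S\<in>K. {x \<in> topspace X. q x \<in> S})" by auto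
    moreover have "openin X (\<Union>S\<in>K. {x \<in> topspace X. q x \<in> S})"
      by (rule openin_Union) (use K in auto)
    ultimately show "\<Union>K \<subseteq> q ` topspace X" "openin X {x \<in> topspace X. q x \<in> \<Union>K}"
      using K by auto
  qed
  then show ?thesis
    by (simp add: quotient_space_def)
qed

lemma topspace_quotient_space: "topspace (quotient_space X q) = q ` topspace X"
proof
  show "topspace (quotient_space X q) \<subseteq> q ` topspace X"
    using openin_quotient_space[of X q "topspace (quotient_space X q)"] by auto
  have "{x \<in> topspace X. q x \<in> q ` topspace X} = topspace X" by auto
  then have "openin (quotient_space X q) (q ` topspace X)"
    by (simp add: openin_quotient_space)
  then show "q ` topspace X \<subseteq> topspace (quotient_space X q)"
    by (rule openin_subset)
qed

lemma quotient_map_quotient_space: "quotient_map X (quotient_space X q) q"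
  unfolding quotient_map_def topspace_quotient_space openin_quotient_space by auto

definition moment_angle_class :: "nat \<Rightarrow> (nat \<Rightarrow> 'p set) \<Rightarrow> bit vec \<times> 'p \<Rightarrow> (bit vec \<times> 'p) set" where
  "moment_angle_class N F =
     (\<lambda>(g, p). {(h, p) |h. h \<in> carrier_vec N \<and>
                           g + h \<in> span2 N {unit_vec N l |l. l < N \<and> p \<in> F l}})"

definition real_moment_angle ::
    "'p topology \<Rightarrow> nat \<Rightarrow> (nat \<Rightarrow> 'p set) \<Rightarrow> (bit vec \<times> 'p) set topology" where
  "real_moment_angle X N F =
     quotient_space (prod_topology (discrete_topology (carrier_vec N)) X) (moment_angle_class N F)"

definition moment_angle_action :: "bit vec \<Rightarrow> (bit vec \<times> 'p) set \<Rightarrow> (bit vec \<times> 'p) set" where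
  "moment_angle_action h z = (\<lambda>(g, p). (h + g, p)) ` z"

definition kernel_orbit :: "bit mat \<Rightarrow> (bit vec \<times> 'p) set \<Rightarrow> (bit vec \<times> 'p) set set" where
  "kernel_orbit L z = (\<lambda>h. moment_angle_action h z) ` mat_kernel L"

definition small_cover ::
    "'p topology \<Rightarrow> nat \<Rightarrow> (nat \<Rightarrow> 'p set) \<Rightarrow> bit mat \<Rightarrow> (bit vec \<times> 'p) set set topology" where
  "small_cover X N F L = quotient_space (real_moment_angle X N F) (kernel_orbit L)"

text \<open>
  The induced action of the \<open>d\<close>-dimensional group, identified via \<open>L\<close> with the quotient of the
  \<open>N\<close>-dimensional one by the kernel of \<open>L\<close>: the vector \<open>a\<close> sends the orbit of \<open>z\<close> to
  the orbit of \<open>h \<cdot> z\<close>, for any \<open>h\<close> with \<open>L h = a\<close>.  Letting \<open>h\<close> range over all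
  solutions and \<open>z\<close> over the whole orbit yields exactly that orbit.
\<close>

definition small_cover_action ::
    "nat \<Rightarrow> bit mat \<Rightarrow> bit vec \<Rightarrow> (bit vec \<times> 'p) set set \<Rightarrow> (bit vec \<times> 'p) set set" where
  "small_cover_action N L a y =
     {moment_angle_action h z |h z. h \<in> carrier_vec N \<and> L *\<^sub>v h = a \<and> z \<in> y}"

definition small_cover_proj :: "(bit vec \<times> 'p) set set \<Rightarrow> 'p" where
  "small_cover_proj y = (THE p. \<exists>z\<in>y. \<exists>g. (g, p) \<in> z)"

text \<open>Over the field with two elements, linear automorphisms are the same as group automorphisms.\<close>

definition DJ_equivalent ::
    "nat \<Rightarrow> 'p topology \<Rightarrow> nat \<Rightarrow> (nat \<Rightarrow> 'p set) \<Rightarrow> bit mat \<Rightarrow> bit mat \<Rightarrow> bool" where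
  "DJ_equivalent d X N F L L' \<longleftrightarrow>
     (\<exists>f \<theta>.
        homeomorphic_map (small_cover X N F L) (small_cover X N F L') f \<and>
        \<theta> \<in> iso (monoid_vec TYPE(bit) d) (monoid_vec TYPE(bit) d) \<and>
        (\<forall>a\<in>carrier_vec d. \<forall>y\<in>topspace (small_cover X N F L).
           f (small_cover_action N L a y) = small_cover_action N L' (\<theta> a) (f y)) \<and>
        (\<forall>y\<in>topspace (small_cover X N F L). small_cover_proj (f y) = small_cover_proj y))"

section \<open>Products of polygons\<close>

text \<open>The polygon with \<open>k \<ge> 3\<close> sides is realised as the regular one inscribed in the unit circle.\<close>

definition polygon_vertex :: "nat \<Rightarrow> nat \<Rightarrow> complex" where
  "polygon_vertex k j = cis (2 * pi * real j / real k)"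

definition polygon :: "nat \<Rightarrow> complex set" where
  "polygon k = convex hull (polygon_vertex k ` {..<k})"

definition polygon_side :: "nat \<Rightarrow> nat \<Rightarrow> complex set" where
  "polygon_side k j = closed_segment (polygon_vertex k j) (polygon_vertex k (Suc j))"

definition polygon_product :: "nat \<Rightarrow> (nat \<Rightarrow> nat) \<Rightarrow> (nat \<Rightarrow> complex) topology" where
  "polygon_product n m = product_topology (\<lambda>i. top_of_set (polygon (m i))) {..<n}"

text \<open>
  The facets are numbered factor by factor: \<open>facet_index m i j\<close>, for \<open>i < n\<close> and \<open>j < m i\<close>,
  is the position of the facet given by side \<open>j\<close> of factor \<open>i\<close>.
\<close>

definition num_facets :: "nat \<Rightarrow> (nat \<Rightarrow> nat) \<Rightarrow> nat" where
  "num_facets n m = (\<Sum>i<n. m i)"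

definition facet_index :: "(nat \<Rightarrow> nat) \<Rightarrow> nat \<Rightarrow> nat \<Rightarrow> nat" where
  "facet_index m i j = (\<Sum>k<i. m k) + j"

definition product_facet :: "nat \<Rightarrow> (nat \<Rightarrow> nat) \<Rightarrow> nat \<Rightarrow> (nat \<Rightarrow> complex) set" where
  "product_facet n m l =
     {p \<in> topspace (polygon_product n m).
        \<exists>i<n. \<exists>j<m i. l = facet_index m i j \<and> p i \<in> polygon_side (m i) j}"

abbreviation product_characteristic_matrix :: "nat \<Rightarrow> (nat \<Rightarrow> nat) \<Rightarrow> bit mat \<Rightarrow> bool" where
  "product_characteristic_matrix n m L \<equiv>
     characteristic_matrix (2 * n) (num_facets n m) (product_facet n m) L"

abbreviation polygon_characteristic_matrix :: "nat \<Rightarrow> bit mat \<Rightarrow> bool" where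
  "polygon_characteristic_matrix k L \<equiv> characteristic_matrix 2 k (polygon_side k) L"

abbreviation product_DJ_equivalent :: "nat \<Rightarrow> (nat \<Rightarrow> nat) \<Rightarrow> bit mat \<Rightarrow> bit mat \<Rightarrow> bool" where
  "product_DJ_equivalent n m L L' \<equiv>
     DJ_equivalent (2 * n) (polygon_product n m) (num_facets n m) (product_facet n m) L L'"

section \<open>Factor-compatibility\<close>

definition facet_vec :: "nat \<Rightarrow> (nat \<Rightarrow> nat) \<Rightarrow> nat \<Rightarrow> nat \<Rightarrow> bit vec" where
  "facet_vec n m i j = unit_vec (num_facets n m) (facet_index m i j)"

definition factor_weight :: "nat \<Rightarrow> (nat \<Rightarrow> nat) \<Rightarrow> nat \<Rightarrow> bit vec" where
  "factor_weight n m i = finsum_vec TYPE(bit) (num_facets n m) (facet_vec n m i) {..<m i}"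

text \<open>The weights of the two interval directions of each square factor.\<close>

definition interval_weights :: "nat \<Rightarrow> (nat \<Rightarrow> nat) \<Rightarrow> bit vec set" where
  "interval_weights n m =
     (\<Union>i\<in>{i. i < n \<and> m i = 4}.
        {facet_vec n m i 0 + facet_vec n m i 2, facet_vec n m i 1 + facet_vec n m i 3})"

definition factor_compatible :: "nat \<Rightarrow> (nat \<Rightarrow> nat) \<Rightarrow> bit mat \<Rightarrow> bool" where
  "factor_compatible n m L \<longleftrightarrow>
     (\<forall>i<n. m i \<noteq> 4 \<longrightarrow> factor_weight n m i \<in> row_sp L) \<and>
     (\<exists>\<P>. partition_on (interval_weights n m) \<P> \<and>
          (\<forall>B\<in>\<P>. \<exists>\<omega> \<omega>'. \<omega> \<noteq> \<omega>' \<and> B = {\<omega>, \<omega>'} \<and> \<omega> + \<omega>' \<in> row_sp L))"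

section \<open>Permuting the factors, and the block structure\<close>

text \<open>
  The matrix \<open>L\<close> over the product with side numbers \<open>m\<close>, regarded as a matrix over the
  product with side numbers \<open>m \<circ> \<sigma>\<close>, whose factor \<open>i\<close> is the former factor \<open>\<sigma> i\<close>.
\<close>

definition permute_factors :: "nat \<Rightarrow> (nat \<Rightarrow> nat) \<Rightarrow> (nat \<Rightarrow> nat) \<Rightarrow> bit mat \<Rightarrow> bit mat" where
  "permute_factors n m \<sigma> L =
     mat_of_cols (dim_row L)
       (concat (map (\<lambda>i. map (\<lambda>j. col L (facet_index m (\<sigma> i) j)) [0..<m (\<sigma> i)]) [0..<n]))"

definition factor_block :: "(nat \<Rightarrow> nat) \<Rightarrow> bit mat \<Rightarrow> nat \<Rightarrow> nat \<Rightarrow> bit mat" where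
  "factor_block m L i j = mat 2 (m j) (\<lambda>(r, c). L $$ (2 * i + r, facet_index m j c))"

definition block_lower_triangular :: "nat \<Rightarrow> (nat \<Rightarrow> nat) \<Rightarrow> bit mat \<Rightarrow> bool" where
  "block_lower_triangular n m L \<longleftrightarrow>
     (\<forall>i<n. \<forall>j<n. i < j \<longrightarrow> factor_block m L i j = 0\<^sub>m 2 (m j))"

end

theory Submission
  imports Defs
begin

text \<open>
  Write \<open>\<lambda>\<close> for the characteristic map and \<open>F i j\<close> for the facet given by side \<open>j\<close> of the factor \<open>i\<close>.
  That the factor weight of \<open>i\<close> lies in the row space means that some linear functional \<open>\<alpha> i\<close> takes
  the value 1 on every \<open>\<lambda> (F i j)\<close> and 0 on the columns of all other factors. Fix a vertex of the
  product, namely the one where sides 0 and 1 of every factor meet, and use the basis made of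
  \<open>\<lambda> (F i 0)\<close> and \<open>\<lambda> (F i 0) + \<lambda> (F i 1)\<close>. In these coordinates the functionals \<open>\<alpha> i\<close> are just the
  even coordinates (\<open>normal_form_exists\<close>), so only the odd coordinates carry information.

  Suppose that two distinct sides \<open>a\<close>, \<open>b\<close> of the factor \<open>k\<close> meet. Then \<open>\<lambda> (F k a) + \<lambda> (F k b)\<close> has
  vanishing even coordinates; its odd part is a vector with one coordinate for each factor, and
  \<open>side_differences\<close> collects these vectors for the factor \<open>k\<close>. Independence of the columns at all
  vertices says that any choice of one such vector per factor gives a square matrix over the field
  with two elements all of whose principal minors are 1 (\<open>side_differences_minors\<close>).

  This forces triangularity. Draw an arrow from \<open>k\<close> to \<open>i\<close> whenever some vector chosen from the factor
  \<open>k\<close> may have a nonzero \<open>i\<close>th coordinate. A shortest cycle would visit every factor at most once and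
  would have no chords, so a single choice of vectors would produce a principal submatrix equal to the
  identity plus a cyclic permutation matrix, which is singular because its columns add up to zero
  (\<open>off_diagonal_zero_exists\<close>). Hence the arrows form an acyclic graph, and ordering the factors
  along it (\<open>triangular_permutation_exists\<close>) makes the matrix block lower triangular: the odd
  coordinate \<open>i\<close> vanishes at side 0 of any other factor, and for earlier \<open>i\<close> it cannot change from one
  side to the next. In a diagonal block every column is \<open>(1, 0)\<close> or \<open>(1, 1)\<close>, and columns of
  meeting sides differ since the principal minor of size one is 1; this makes the block
  characteristic.

  Apart from the permutation of the factors, \<open>\<lambda>\<close> is only multiplied by an invertible matrix on the
  left. Such a change keeps the kernel of \<open>\<lambda>\<close>, hence the small cover itself, and only twists the
  action, so the identity map is a Davis--Januszkiewicz equivalence (\<open>DJ_equivalent_mult_left\<close>).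
\<close>

unbundle no vec_syntax

text \<open>
  By default the simplifier turns sums and products of bits into bitwise operations, to which the
  rules for sums in a commutative ring do not apply.
\<close>

declare add_bit_eq_xor [simp del] mult_bit_eq_and [simp del]

section \<open>Independence and coordinates over the field with two elements\<close>

lemma bit_add_self [simp]: "x + x = (0::bit)"
  by (cases x) simp_all

text \<open>
  A linear combination over the field with two elements is a subset sum: keep the vectors whose
  coefficient is 1. Injectivity of the family is included, since two equal members would have sum 0.
\<close>

lemma lin_indpt_family_iff:
  assumes finS: "finite S" and v: "\<And>l. l \<in> S \<Longrightarrow> v l \<in> carrier_vec d"
  shows "lin_indpt_family d v S \<longleftrightarrow>
    (\<forall>T\<subseteq>S. T \<noteq> {} \<longrightarrow> (\<exists>r<d. (\<Sum>l\<in>T. v l $ r) \<noteq> 0))" (is "?L \<longleftrightarrow> ?R")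
proof -
  interpret vec_space "TYPE(bit)" d .
  show ?thesis
  proof
    assume ?L
    then have inj: "inj_on v S" and indep: "lin_indpt2 d (v ` S)"
      by (auto simp: lin_indpt_family_def)
    show ?R
    proof (intro allI impI, rule ccontr)
      fix T assume T: "T \<subseteq> S" "T \<noteq> {}" and no: "\<not> (\<exists>r<d. (\<Sum>l\<in>T. v l $ r) \<noteq> 0)"
      have vT: "v ` T \<subseteq> carrier_vec d" using v T by auto
      have injT: "inj_on v T" using inj T inj_on_subset by blast
      have "lincomb (\<lambda>_. 1) (v ` T) = 0\<^sub>v d"
      proof (rule eq_vecI)
        show "dim_vec (lincomb (\<lambda>_. 1) (v ` T)) = dim_vec (0\<^sub>v d)"
          using vT finite_subset[OF T(1) finS] by (auto intro!: lincomb_dim)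
        fix r assume "r < dim_vec (0\<^sub>v d :: bit vec)"
        then show "lincomb (\<lambda>_. 1) (v ` T) $ r = 0\<^sub>v d $ r"
          using no by (simp add: lincomb_index[OF _ vT] sum.reindex[OF injT])
      qed
      moreover obtain t where "t \<in> T" using T by auto
      moreover have "finite (v ` T)" using finite_subset[OF T(1) finS] by simp
      ultimately have "lin_dep (v ` S)"
        using T by (intro lin_dep_crit[where A = "v ` T" and a = "\<lambda>_. 1" and v = "v t"]) auto
      then show False using indep by simp
    qed
  next
    assume R: ?R
    have inj: "inj_on v S"
    proof (rule inj_onI, rule ccontr)
      fix k l assume kl: "k \<in> S" "l \<in> S" "v k = v l" "k \<noteq> l"
      then have "(\<Sum>l\<in>{k, l}. v l $ r) = 0" for r by simp
      moreover have "\<exists>r<d. (\<Sum>l\<in>{k, l}. v l $ r) \<noteq> 0"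
        using kl by (intro R[rule_format]) auto
      ultimately show False by blast
    qed
    moreover have "lin_indpt2 d (v ` S)"
    proof
      assume "lin_dep (v ` S)"
      then obtain A a w where A: "finite A" "A \<subseteq> v ` S" "lincomb a A = 0\<^sub>v d"
        and w: "w \<in> A" "a w \<noteq> 0"
        unfolding lin_dep_def by (elim exE conjE) simp
      define T where "T = {l \<in> S. v l \<in> A \<and> a (v l) \<noteq> 0}"
      have "T \<noteq> {}" using w A by (auto simp: T_def)
      then obtain r where r: "r < d" "(\<Sum>l\<in>T. v l $ r) \<noteq> 0"
        using R[rule_format, of T] by (auto simp: T_def)
      have "(\<Sum>l\<in>T. v l $ r) = (\<Sum>x\<in>v ` T. x $ r)"
        by (subst sum.reindex) (auto intro: inj_on_subset[OF inj] simp: T_def)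
      also have "\<dots> = (\<Sum>x\<in>v ` T. a x * x $ r)"
        by (intro sum.cong) (auto simp: T_def)
      also have "\<dots> = (\<Sum>x\<in>A. a x * x $ r)"
      proof (intro sum.mono_neutral_left ballI)
        fix x assume "x \<in> A - v ` T"
        then have "a x = 0" using A(2) by (force simp: T_def)
        then show "a x * x $ r = 0" by simp
      qed (use A in \<open>auto simp: T_def\<close>)
      also have "\<dots> = lincomb a A $ r"
        using A v r by (subst lincomb_index) auto
      also have "\<dots> = 0" using A r by simp
      finally show False using r by simp
    qed
    ultimately show ?L by (simp add: lin_indpt_family_def)
  qed
qed

lemma lin_indpt_familyI:
  assumes "finite S" and "\<And>l. l \<in> S \<Longrightarrow> v l \<in> carrier_vec d"
    and "\<And>T. T \<subseteq> S \<Longrightarrow> T \<noteq> {} \<Longrightarrow> (\<And>r. r < d \<Longrightarrow> (\<Sum>l\<in>T. v l $ r) = 0) \<Longrightarrow> False"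
  shows "lin_indpt_family d v S"
  using assms by (subst lin_indpt_family_iff) blast+

lemma lin_indpt_familyD:
  assumes "lin_indpt_family d v S" and "finite S" and "\<And>l. l \<in> S \<Longrightarrow> v l \<in> carrier_vec d"
    and "T \<subseteq> S" and "T \<noteq> {}"
  obtains r where "r < d" "(\<Sum>l\<in>T. v l $ r) \<noteq> 0"
  using assms by (subst (asm) lin_indpt_family_iff) blast+

text \<open>
  A nonzero subset sum stays nonzero under an injective matrix.
\<close>

lemma lin_indpt_family_mult_mat_vec:
  assumes A: "A \<in> carrier_mat d d" "det A \<noteq> 0"
    and S: "finite S" and v: "\<And>l. l \<in> S \<Longrightarrow> v l \<in> carrier_vec d"
    and indep: "lin_indpt_family d v S"
  shows "lin_indpt_family d (\<lambda>l. A *\<^sub>v v l) S"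
proof (rule lin_indpt_familyI[OF S])
  show "A *\<^sub>v v l \<in> carrier_vec d" if "l \<in> S" for l
    using A v[OF that] by simp
  fix T assume T: "T \<subseteq> S" "T \<noteq> {}" and zero: "\<And>r. r < d \<Longrightarrow> (\<Sum>l\<in>T. (A *\<^sub>v v l) $ r) = 0"
  define u where "u = vec d (\<lambda>r. \<Sum>l\<in>T. v l $ r)"
  have "A *\<^sub>v u = 0\<^sub>v d"
  proof (rule eq_vecI)
    fix r assume "r < dim_vec (0\<^sub>v d :: bit vec)"
    then have r: "r < d" by simp
    have "(A *\<^sub>v u) $ r = (\<Sum>s<d. A $$ (r, s) * (\<Sum>l\<in>T. v l $ s))"
      using A r by (simp add: u_def scalar_prod_def lessThan_atLeast0 row_def)
    also have "\<dots> = (\<Sum>l\<in>T. \<Sum>s<d. A $$ (r, s) * v l $ s)"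
      unfolding sum_distrib_left by (rule sum.swap)
    also have "\<dots> = (\<Sum>l\<in>T. (A *\<^sub>v v l) $ r)"
    proof (intro sum.cong refl)
      fix l assume "l \<in> T"
      then have "dim_vec (v l) = d" using T v by (meson carrier_vecD subsetD)
      then show "(\<Sum>s<d. A $$ (r, s) * v l $ s) = (A *\<^sub>v v l) $ r"
        using A r by (simp add: scalar_prod_def lessThan_atLeast0)
    qed
    finally show "(A *\<^sub>v u) $ r = 0\<^sub>v d $ r" using zero r by simp
  qed (use A in simp)
  then have "u = 0\<^sub>v d"
    using A(2) det_0_iff_vec_prod_zero[OF A(1)] by (metis u_def vec_carrier)
  moreover obtain r where "r < d" "(\<Sum>l\<in>T. v l $ r) \<noteq> 0"
    using lin_indpt_familyD[OF indep S v T] by blast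
  ultimately show False
    by (auto simp: u_def vec_eq_iff)
qed

lemma det_nonzero_inverse:
  assumes "A \<in> carrier_mat d d" "det A \<noteq> (0::'a::field)"
  obtains B where "B \<in> carrier_mat d d" "A * B = 1\<^sub>m d" "B * A = 1\<^sub>m d"
  using det_non_zero_imp_unit[OF assms, of "()"] by (auto simp: Units_def ring_mat_simps)

text \<open>
  The matrix \<open>A\<close> is the inverse of the matrix with columns \<open>v s\<close>. The last property identifies its
  rows: the functional that is 1 on \<open>v t\<close> and 0 on the other basis vectors is the \<open>t\<close>th coordinate.
\<close>

lemma coordinates_in_basis:
  fixes v :: "nat \<Rightarrow> 'a::field vec"
  assumes v: "\<And>s. s < d \<Longrightarrow> v s \<in> carrier_vec d"
    and indep: "\<And>c s. (\<And>r. r < d \<Longrightarrow> (\<Sum>s<d. v s $ r * c s) = 0) \<Longrightarrow> s < d \<Longrightarrow> c s = 0"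
  obtains A where "A \<in> carrier_mat d d" "det A \<noteq> 0" "\<And>s. s < d \<Longrightarrow> A *\<^sub>v v s = unit_vec d s"
    "\<And>t x (u :: 'a vec). x \<in> carrier_vec d \<Longrightarrow> u \<in> carrier_vec d \<Longrightarrow> t < d \<Longrightarrow>
      (\<And>s. s < d \<Longrightarrow> v s \<bullet> x = of_bool (s = t)) \<Longrightarrow> (A *\<^sub>v u) $ t = u \<bullet> x"
proof -
  define B where "B = mat d d (\<lambda>(r, s). v s $ r)"
  have B: "B \<in> carrier_mat d d" by (simp add: B_def)
  have col_B: "col B s = v s" if "s < d" for s using v[OF that] that by (auto simp: B_def)
  have "det B \<noteq> 0"
  proof
    assume "det B = 0"
    then obtain u where u: "u \<in> carrier_vec d" "u \<noteq> 0\<^sub>v d" "B *\<^sub>v u = 0\<^sub>v d"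
      using det_0_iff_vec_prod_zero[OF B] by auto
    have "(\<Sum>s<d. v s $ r * u $ s) = 0" if "r < d" for r
    proof -
      have "(\<Sum>s<d. v s $ r * u $ s) = (B *\<^sub>v u) $ r"
        using that u(1) by (simp add: B_def scalar_prod_def lessThan_atLeast0)
      then show ?thesis using u(3) that by simp
    qed
    then have "u $ s = 0" if "s < d" for s using indep that by blast
    then show False using u(1,2) by (auto simp: vec_eq_iff)
  qed
  then obtain A where A: "A \<in> carrier_mat d d" "A * B = 1\<^sub>m d" "B * A = 1\<^sub>m d"
    using det_nonzero_inverse[OF B] by blast
  show thesis
  proof (rule that[OF A(1)])
    show "det A \<noteq> 0"
      using arg_cong[OF A(2), of det] by (cases "det A = 0") (simp_all add: det_mult[OF A(1) B])
    show "A *\<^sub>v v s = unit_vec d s" if s: "s < d" for s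
      using A B s col_mult2[OF A(1) B s] by (simp add: col_B)
    fix x u :: "'a vec" and t assume x: "x \<in> carrier_vec d" and u: "u \<in> carrier_vec d" and t: "t < d"
      and dual: "\<And>s. s < d \<Longrightarrow> v s \<bullet> x = of_bool (s = t)"
    have "B\<^sup>T *\<^sub>v x = unit_vec d t"
      using B x dual t by (intro eq_vecI) (auto simp: col_B)
    have "u = B *\<^sub>v (A *\<^sub>v u)"
      using A(1,3) B u by (metis assoc_mult_mat_vec one_mult_mat_vec)
    then have "x \<bullet> u = x \<bullet> (B *\<^sub>v (A *\<^sub>v u))" by simp
    also have "\<dots> = (B\<^sup>T *\<^sub>v x) \<bullet> (A *\<^sub>v u)"
      using A B u x by (simp add: transpose_vec_mult_scalar)
    also have "\<dots> = (A *\<^sub>v u) $ t"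
      using A u t by (simp add: \<open>B\<^sup>T *\<^sub>v x = unit_vec d t\<close>)
    finally show "(A *\<^sub>v u) $ t = u \<bullet> x"
      using comm_scalar_prod[OF x u] by simp
  qed
qed

section \<open>Row operations preserve the small cover\<close>

lemma mult_mat_vec_zero:
  assumes "A \<in> carrier_mat nr nc"
  shows "A *\<^sub>v 0\<^sub>v nc = 0\<^sub>v nr"
  using assms by (auto intro!: eq_vecI)

text \<open>
  Both matrices have the same kernel, so the two small covers are literally the same space. An element
  of the big group that maps to \<open>a\<close> under \<open>L\<close> maps to \<open>A a\<close> under \<open>A * L\<close>; therefore the identity map is
  equivariant up to the automorphism \<open>A\<close>.
\<close>

lemma DJ_equivalent_mult_left:
  assumes L: "L \<in> carrier_mat d N" and A: "A \<in> carrier_mat d d" "det A \<noteq> 0"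
  shows "DJ_equivalent d X N F L (A * L)"
proof -
  obtain B where B: "B \<in> carrier_mat d d" "A * B = 1\<^sub>m d" "B * A = 1\<^sub>m d"
    using det_nonzero_inverse[OF A] .
  have BA: "B *\<^sub>v (A *\<^sub>v u) = u" and AB: "A *\<^sub>v (B *\<^sub>v u) = u" if "u \<in> carrier_vec d" for u
    by (metis that A(1) B assoc_mult_mat_vec one_mult_mat_vec)+
  have AL: "(A * L) *\<^sub>v h = A *\<^sub>v w \<longleftrightarrow> L *\<^sub>v h = w"
    if "h \<in> carrier_vec N" "w \<in> carrier_vec d" for h w
  proof -
    have "L *\<^sub>v h \<in> carrier_vec d" "(A * L) *\<^sub>v h = A *\<^sub>v (L *\<^sub>v h)"
      using A L that by simp_all
    then show ?thesis using BA that(2) by metis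
  qed
  have "mat_kernel (A * L) = mat_kernel L"
    using A(1) L AL[of _ "0\<^sub>v d"] mult_mat_vec_zero[OF A(1)]
    by (auto simp: mat_kernel[OF L] mat_kernel[OF mult_carrier_mat[OF A(1) L]])
  then have cover: "small_cover X N F (A * L) = small_cover X N F L"
    by (simp add: small_cover_def kernel_orbit_def[abs_def])
  have action: "small_cover_action N L a y = small_cover_action N (A * L) (A *\<^sub>v a) y"
    if a: "a \<in> carrier_vec d" for a y
    unfolding small_cover_action_def by (simp only: AL[OF _ a] cong: conj_cong)
  have "bij_betw ((*\<^sub>v) A) (carrier_vec d) (carrier_vec d)"
    using A B AB BA by (intro bij_betw_byWitness[where f' = "(*\<^sub>v) B"]) auto
  then have "(*\<^sub>v) A \<in> iso (monoid_vec TYPE(bit) d) (monoid_vec TYPE(bit) d)"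
    using A by (auto simp: iso_def hom_def monoid_vec_simps mult_add_distrib_mat_vec)
  then show ?thesis
    unfolding DJ_equivalent_def cover
    by (intro exI[of _ id] exI[of _ "(*\<^sub>v) A"]) (auto simp: action homeomorphic_map_id)
qed

section \<open>Matrices with nonsingular principal submatrices\<close>

text \<open>
  The hypothesis says that the square matrices with columns \<open>v k \<in> D k\<close> have nonsingular principal
  submatrices, in the form that the columns of none of them add up to zero: a relation between some of
  the columns already shows up in the smaller principal submatrix on the indices involved.
  If the conclusion failed, every \<open>k\<close> would have an arrow to another element of \<open>S\<close>. Take a minimal nonempty subset \<open>T\<close> in
  which every element still has an arrow inside \<open>T\<close>. Minimality makes any choice of arrows a
  permutation of \<open>T\<close> and leaves only one possible choice, so on \<open>T\<close> each column has exactly the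
  entries forced by the diagonal and by this permutation, and these columns add up to zero.
\<close>

lemma off_diagonal_zero_exists:
  fixes D :: "'i \<Rightarrow> ('i \<Rightarrow> bit) set"
  assumes S: "finite S" "S \<noteq> {}"
    and minors: "\<And>T v. T \<subseteq> S \<Longrightarrow> T \<noteq> {} \<Longrightarrow> (\<And>k. k \<in> T \<Longrightarrow> v k \<in> D k) \<Longrightarrow>
      \<exists>i\<in>T. (\<Sum>k\<in>T. v k i) \<noteq> 0"
  shows "\<exists>k\<in>S. \<forall>v\<in>D k. \<forall>i\<in>S - {k}. v i = 0"
proof (rule ccontr)
  have diag: "w k = 1" if "k \<in> S" "w \<in> D k" for k w
    using minors[of "{k}" "\<lambda>_. w"] that by simp
  define closed where
    "closed T \<longleftrightarrow> T \<subseteq> S \<and> T \<noteq> {} \<and> (\<forall>k\<in>T. \<exists>v\<in>D k. \<exists>i\<in>T - {k}. v i = 1)" for T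
  assume "\<not> ?thesis"
  then have "closed S" using S by (auto simp: closed_def)
  then obtain T where T: "closed T" and min: "\<And>U. closed U \<Longrightarrow> card T \<le> card U"
    using ex_has_least_nat[of closed S card] by blast
  have finT: "finite T" using T S finite_subset by (auto simp: closed_def)
  have "\<forall>k\<in>T. \<exists>v i. v \<in> D k \<and> i \<in> T - {k} \<and> v i = 1"
    using T by (auto simp: closed_def)
  then obtain v f where v: "\<And>k. k \<in> T \<Longrightarrow> v k \<in> D k"
    and f: "\<And>k. k \<in> T \<Longrightarrow> f k \<in> T - {k}" "\<And>k. k \<in> T \<Longrightarrow> v k (f k) = 1"
    by metis
  \<comment> \<open>The targets of any choice of arrows again have arrows among themselves, so by minimality every
    element is a target.\<close>
  have onto: "g ` T = T"
    if g: "\<And>k. k \<in> T \<Longrightarrow> g k \<in> T - {k}" "\<And>k. k \<in> T \<Longrightarrow> v k (g k) = 1" for g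
  proof (rule card_seteq[OF finT])
    show "g ` T \<subseteq> T" using g(1) by auto
    have "\<exists>w\<in>D k. \<exists>i\<in>g ` T - {k}. w i = 1" if "k \<in> g ` T" for k
    proof -
      have "k \<in> T" using that g(1) by auto
      then show ?thesis using v g by blast
    qed
    then have "closed (g ` T)"
      using T \<open>g ` T \<subseteq> T\<close> by (auto simp: closed_def)
    then show "card T \<le> card (g ` T)" by (rule min)
  qed
  have inj: "inj_on f T"
    using onto[OF f] finT by (simp add: eq_card_imp_inj_on)
  \<comment> \<open>Redirecting the arrow of one element to a different target would leave its old target unhit.\<close>
  have chordless: "i = f k" if ki: "k \<in> T" "i \<in> T - {k}" "v k i = 1" for k i
  proof (rule ccontr)
    assume "i \<noteq> f k"
    have "(f(k := i)) ` T = T"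
      using f ki by (intro onto) auto
    then obtain l where "l \<in> T" "f k = (f(k := i)) l"
      using f(1)[OF ki(1)] by (metis DiffD1 imageE)
    then show False
      using \<open>i \<noteq> f k\<close> inj_onD[OF inj, of k l] ki by (auto split: if_splits)
  qed
  have entry: "v k i = of_bool (k = i) + of_bool (f k = i)" if "k \<in> T" "i \<in> T" for k i
    using that diag[of k "v k"] v[of k] f[of k] chordless[of k i] T
    by (cases "v k i = 1") (auto simp: closed_def)
  obtain i where i: "i \<in> T" "(\<Sum>k\<in>T. v k i) \<noteq> 0"
    using minors[of T v] T v by (auto simp: closed_def)
  have "(\<Sum>k\<in>T. v k i) = (\<Sum>k\<in>T. of_bool (k = i)) + (\<Sum>k\<in>T. of_bool (f k = i))"
    using entry i by (simp add: sum.distrib)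
  also have "(\<Sum>k\<in>T. of_bool (f k = i)) = (\<Sum>k\<in>f ` T. of_bool (k = i) :: bit)"
    using inj by (simp add: sum.reindex)
  also have "f ` T = T" by (rule onto[OF f])
  finally show False using i by simp
qed

text \<open>
  An element whose vectors vanish off the diagonal is put last; the rest is ordered recursively.
\<close>

lemma triangular_order_exists:
  fixes D :: "'i \<Rightarrow> ('i \<Rightarrow> bit) set"
  assumes S: "finite S"
    and minors: "\<And>T v. T \<subseteq> S \<Longrightarrow> T \<noteq> {} \<Longrightarrow> (\<And>k. k \<in> T \<Longrightarrow> v k \<in> D k) \<Longrightarrow>
      \<exists>i\<in>T. (\<Sum>k\<in>T. v k i) \<noteq> 0"
  shows "\<exists>xs. distinct xs \<and> set xs = S \<and>
    (\<forall>p q. p < q \<longrightarrow> q < length xs \<longrightarrow> (\<forall>v\<in>D (xs ! q). v (xs ! p) = 0))"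
  using assms
proof (induction S rule: finite_psubset_induct)
  case (psubset S)
  show ?case
  proof (cases "S = {}")
    case False
    obtain k where k: "k \<in> S" "\<forall>v\<in>D k. \<forall>i\<in>S - {k}. v i = 0"
      using off_diagonal_zero_exists[OF psubset.hyps False psubset.prems] by blast
    have "\<exists>xs. distinct xs \<and> set xs = S - {k} \<and>
        (\<forall>p q. p < q \<longrightarrow> q < length xs \<longrightarrow> (\<forall>v\<in>D (xs ! q). v (xs ! p) = 0))"
    proof (rule psubset.IH)
      show "S - {k} \<subset> S" using k by auto
      show "\<exists>i\<in>T. (\<Sum>l\<in>T. v l i) \<noteq> 0"
        if "T \<subseteq> S - {k}" "T \<noteq> {}" "\<And>l. l \<in> T \<Longrightarrow> v l \<in> D l" for T v
        using that by (intro psubset.prems) auto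
    qed
    then obtain xs where xs: "distinct xs" "set xs = S - {k}"
      "\<forall>p q. p < q \<longrightarrow> q < length xs \<longrightarrow> (\<forall>v\<in>D (xs ! q). v (xs ! p) = 0)"
      by blast
    have "v ((xs @ [k]) ! p) = 0"
      if "p < q" "q < length (xs @ [k])" "v \<in> D ((xs @ [k]) ! q)" for p q v
    proof (cases "q < length xs")
      case True
      then show ?thesis using that xs(3) by (simp add: nth_append)
    next
      case False
      then have "q = length xs" using that by simp
      moreover have "xs ! p \<in> S - {k}" using that xs(2) calculation nth_mem by blast
      ultimately show ?thesis using that k by (simp add: nth_append)
    qed
    then show ?thesis
      using xs(1,2) k(1) by (intro exI[of _ "xs @ [k]"]) auto
  qed (auto intro: exI[of _ "[]"])
qed

lemma triangular_permutation_exists: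
  fixes D :: "nat \<Rightarrow> (nat \<Rightarrow> bit) set"
  assumes minors: "\<And>T v. T \<subseteq> {..<n} \<Longrightarrow> T \<noteq> {} \<Longrightarrow> (\<And>k. k \<in> T \<Longrightarrow> v k \<in> D k) \<Longrightarrow>
      \<exists>i\<in>T. (\<Sum>k\<in>T. v k i) \<noteq> 0"
  obtains \<sigma> where "\<sigma> permutes {..<n}"
    "\<And>i j v. i < j \<Longrightarrow> j < n \<Longrightarrow> v \<in> D (\<sigma> j) \<Longrightarrow> v (\<sigma> i) = 0"
proof -
  obtain xs where xs: "distinct xs" "set xs = {..<n}"
    "\<forall>p q. p < q \<longrightarrow> q < length xs \<longrightarrow> (\<forall>v\<in>D (xs ! q). v (xs ! p) = 0)"
    using triangular_order_exists[OF finite_lessThan[of n], of D] minors by auto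
  have len: "length xs = n" using distinct_card[OF xs(1)] xs(2) by simp
  define \<sigma> where "\<sigma> i = (if i < n then xs ! i else i)" for i
  have "bij_betw ((!) xs) {..<n} {..<n}"
    using bij_betw_nth[OF xs(1)] xs(2) len by blast
  then have "bij_betw \<sigma> {..<n} {..<n}"
    by (rule bij_betw_cong[THEN iffD1, rotated]) (simp add: \<sigma>_def)
  then have "\<sigma> permutes {..<n}"
    by (rule bij_imp_permutes) (simp add: \<sigma>_def)
  then show thesis
    using that[of \<sigma>] xs(3) len by (simp add: \<sigma>_def)
qed

section \<open>Facets of products of polygons\<close>

lemma facet_index_less_facet_index:
  assumes "i < i'" "j < m i"
  shows "facet_index m i j < facet_index m i' j'"
proof -
  have "facet_index m i j < (\<Sum>k<Suc i. m k)" using assms by (simp add: facet_index_def)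
  also have "\<dots> \<le> (\<Sum>k<i'. m k)" using assms by (intro sum_mono2) auto
  finally show ?thesis by (simp add: facet_index_def)
qed

lemma facet_index_less:
  assumes "i < n" "j < m i"
  shows "facet_index m i j < num_facets n m"
  using facet_index_less_facet_index[of i n j m 0] assms by (simp add: facet_index_def num_facets_def)

lemma facet_index_eq_iff:
  assumes "j < m i" "j' < m i'"
  shows "facet_index m i j = facet_index m i' j' \<longleftrightarrow> i = i' \<and> j = j'"
proof (cases i i' rule: linorder_cases)
  case less
  then show ?thesis using facet_index_less_facet_index[of i i' j m j'] assms by simp
next
  case greater
  then show ?thesis using facet_index_less_facet_index[of i' i j' m j] assms by simp
qed (simp add: facet_index_def)

lemma facet_index_exhaust:
  assumes "l < num_facets n m"
  shows "\<exists>i j. i < n \<and> j < m i \<and> l = facet_index m i j"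
  using assms
proof (induction n)
  case (Suc n)
  show ?case
  proof (cases "l < num_facets n m")
    case False
    then have "l = facet_index m n (l - num_facets n m)" "l - num_facets n m < m n"
      using Suc.prems by (auto simp: facet_index_def num_facets_def)
    then show ?thesis by blast
  qed (use Suc.IH less_SucI in blast)
qed (simp add: num_facets_def)

lemma product_facet_iff:
  assumes "i < n" "j < m i"
  shows "p \<in> product_facet n m (facet_index m i j) \<longleftrightarrow>
    p \<in> (\<Pi>\<^sub>E k\<in>{..<n}. polygon (m k)) \<and> p i \<in> polygon_side (m i) j"
proof -
  have "(\<exists>k<n. \<exists>h<m k. facet_index m i j = facet_index m k h \<and> p k \<in> polygon_side (m k) h) \<longleftrightarrow>
    p i \<in> polygon_side (m i) j"
    using assms facet_index_eq_iff[of j m i] by metis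
  then show ?thesis
    unfolding product_facet_def by (simp add: polygon_product_def)
qed

text \<open>
  The last side ends at the vertex number \<open>k\<close>, which is the vertex 0 by periodicity.
\<close>

lemma polygon_side_subset:
  assumes "j < k"
  shows "polygon_side k j \<subseteq> polygon k"
proof -
  have "polygon_vertex k (Suc j) \<in> polygon_vertex k ` {..<k}"
  proof (cases "Suc j = k")
    case True
    then have "polygon_vertex k (Suc j) = polygon_vertex k 0"
      using assms by (simp add: polygon_vertex_def)
    then show ?thesis using assms by auto
  qed (use assms in auto)
  then show ?thesis
    unfolding polygon_side_def polygon_def
    using assms by (intro closed_segment_subset_convex_hull) (auto intro: hull_inc)
qed

lemma consecutive_sides_meet:
  "polygon_side k j \<inter> polygon_side k (Suc j) \<noteq> {}"
  using ends_in_segment by (auto simp: polygon_side_def)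

text \<open>
  Points chosen independently in the factors form a point of the product. So if the sides in \<open>J i\<close> have
  a common point for every \<open>i\<close>, then all these facets together have a common point, and their columns
  are independent.
\<close>

lemma meeting_facets_independent:
  assumes M: "product_characteristic_matrix n m M"
    and J: "\<And>i. i < n \<Longrightarrow> J i \<subseteq> {..<m i}" "\<And>i. i < n \<Longrightarrow> J i \<noteq> {}"
    and meet: "\<And>i. i < n \<Longrightarrow> (\<Inter>j\<in>J i. polygon_side (m i) j) \<noteq> {}"
    and zero: "\<And>r. r < 2 * n \<Longrightarrow> (\<Sum>i<n. \<Sum>j\<in>J i. c i j * M $$ (r, facet_index m i j)) = 0"
    and ij: "i < n" "j \<in> J i"
  shows "c i j = 0"
proof (rule ccontr)
  assume c: "c i j \<noteq> 0"
  have carrier: "M \<in> carrier_mat (2 * n) (num_facets n m)"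
    using M by (simp add: characteristic_matrix_def)
  have "\<forall>i\<in>{..<n}. \<exists>y. y \<in> (\<Inter>j\<in>J i. polygon_side (m i) j)"
    using meet by blast
  then obtain x where "\<forall>i\<in>{..<n}. x i \<in> (\<Inter>j\<in>J i. polygon_side (m i) j)"
    by (rule bchoice[THEN exE])
  then have x: "x i \<in> polygon_side (m i) j" if "i < n" "j \<in> J i" for i j
    using that by simp
  define p where "p = restrict x {..<n}"
  define I where "I = (SIGMA i:{..<n}. J i)"
  define \<phi> where "\<phi> = (\<lambda>(i, j). facet_index m i j)"
  have inj: "inj_on \<phi> I"
    using J(1) by (auto simp: inj_on_def \<phi>_def I_def facet_index_eq_iff subset_iff)
  have finJ: "finite (J i)" if "i < n" for i using J(1)[OF that] finite_subset by blast
  have finI: "finite I" using finJ by (auto simp: I_def)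
  have range: "\<phi> ` I \<subseteq> {..<num_facets n m}"
    using J(1) by (auto simp: \<phi>_def I_def intro!: facet_index_less)
  have "x i \<in> polygon (m i)" if i: "i < n" for i
  proof -
    obtain j where "j \<in> J i" using J(2)[OF i] by auto
    then show ?thesis using polygon_side_subset[of j "m i"] J(1)[OF i] x[OF i] by auto
  qed
  then have "p \<in> (\<Inter>l\<in>\<phi> ` I. product_facet n m l)"
    using x J(1) by (auto simp: \<phi>_def I_def product_facet_iff p_def subset_iff)
  then have "(\<Inter>l\<in>\<phi> ` I. product_facet n m l) \<noteq> {}" by blast
  then have indep: "lin_indpt_family (2 * n) (col M) (\<phi> ` I)"
    using M range unfolding characteristic_matrix_def by blast
  define T where "T = {(i, j) \<in> I. c i j \<noteq> 0}"
  obtain r where r: "r < 2 * n" "(\<Sum>l\<in>\<phi> ` T. col M l $ r) \<noteq> 0"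
  proof (rule lin_indpt_familyD[OF indep])
    show "\<phi> ` T \<noteq> {}" using ij c by (auto simp: T_def I_def)
    show "\<phi> ` T \<subseteq> \<phi> ` I" by (auto simp: T_def)
    show "finite (\<phi> ` I)" using finI by simp
    show "col M l \<in> carrier_vec (2 * n)" for l
      using carrier col_dim carrier_matD(1) by metis
  qed (rule that)
  have "(\<Sum>l\<in>\<phi> ` T. col M l $ r) = (\<Sum>(i, j)\<in>T. M $$ (r, facet_index m i j))"
    using r range carrier inj_on_subset[OF inj, of T]
    by (subst sum.reindex) (auto simp: T_def \<phi>_def subset_iff intro!: sum.cong)
  also have "\<dots> = (\<Sum>(i, j)\<in>I. c i j * M $$ (r, facet_index m i j))"
    using finI by (intro sum.mono_neutral_cong_left) (auto simp: T_def)
  also have "\<dots> = (\<Sum>i<n. \<Sum>j\<in>J i. c i j * M $$ (r, facet_index m i j))"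
    using finJ by (simp add: I_def sum.Sigma)
  finally show False using r zero by simp
qed

section \<open>Characteristic matrices under row operations and permutations of factors\<close>

lemma characteristic_matrix_mult_left:
  assumes L: "characteristic_matrix d N F L" and A: "A \<in> carrier_mat d d" "det A \<noteq> 0"
  shows "characteristic_matrix d N F (A * L)"
  unfolding characteristic_matrix_def
proof (intro conjI allI impI)
  have carrier: "L \<in> carrier_mat d N" using L by (simp add: characteristic_matrix_def)
  then show "A * L \<in> carrier_mat d N" using A by simp
  fix S assume S: "S \<subseteq> {..<N}" and meet: "(\<Inter>l\<in>S. F l) \<noteq> {}"
  have "lin_indpt_family d (col L) S"
    using L S meet unfolding characteristic_matrix_def by blast
  then have indep: "lin_indpt_family d (\<lambda>l. A *\<^sub>v col L l) S"
    using A S carrier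
    by (intro lin_indpt_family_mult_mat_vec) (auto intro: finite_subset[OF S])
  have "A *\<^sub>v col L l = col (A * L) l" if "l \<in> S" for l
    using that S col_mult2[OF A(1) carrier] by auto
  then show "lin_indpt_family d (col (A * L)) S"
    using indep unfolding lin_indpt_family_def by (simp cong: inj_on_cong image_cong)
qed

lemma lin_indpt_family_reindex:
  assumes "lin_indpt_family d v (\<tau> ` S)" and "inj_on \<tau> S" and "\<And>l. l \<in> S \<Longrightarrow> w l = v (\<tau> l)"
  shows "lin_indpt_family d w S"
proof -
  have "w ` S = v ` \<tau> ` S" using assms(3) by (simp add: image_image)
  moreover have "inj_on w S"
    using assms by (auto simp: lin_indpt_family_def inj_on_def)
  ultimately show ?thesis using assms(1) by (simp add: lin_indpt_family_def)
qed

lemma length_concat_map_upt: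
  "length (concat (map (\<lambda>i. map (g i) [0..<k i]) [0..<n])) = num_facets n k"
  by (induction n) (simp_all add: num_facets_def)

lemma nth_concat_map_upt:
  assumes "i < n" "j < k i"
  shows "concat (map (\<lambda>i. map (g i) [0..<k i]) [0..<n]) ! facet_index k i j = g i j"
  using assms
proof (induction n)
  case (Suc n)
  show ?case
  proof (cases "i = n")
    case True
    then show ?thesis using Suc.prems
      by (simp add: nth_append length_concat_map_upt facet_index_def num_facets_def)
  next
    case False
    then have "facet_index k i j < num_facets n k"
      using Suc.prems by (intro facet_index_less) auto
    then show ?thesis using Suc False by (simp add: nth_append length_concat_map_upt)
  qed
qed simp

lemma permute_factors_carrier:
  assumes L: "L \<in> carrier_mat d (num_facets n m)"
  shows "permute_factors n m \<sigma> L \<in> carrier_mat d (num_facets n (m \<circ> \<sigma>))"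
  using L length_concat_map_upt[of "\<lambda>i j. col L (facet_index m (\<sigma> i) j)" "m \<circ> \<sigma>" n]
  by (intro carrier_matI) (simp_all add: permute_factors_def)

lemma col_permute_factors:
  assumes "i < n" "j < m (\<sigma> i)"
  shows "col (permute_factors n m \<sigma> L) (facet_index (m \<circ> \<sigma>) i j) = col L (facet_index m (\<sigma> i) j)"
proof -
  let ?cols = "concat (map (\<lambda>i. map (\<lambda>j. col L (facet_index m (\<sigma> i) j)) [0..<m (\<sigma> i)]) [0..<n])"
  have nth: "?cols ! facet_index (m \<circ> \<sigma>) i j = col L (facet_index m (\<sigma> i) j)"
    using nth_concat_map_upt[of i n j "m \<circ> \<sigma>" "\<lambda>i j. col L (facet_index m (\<sigma> i) j)"] assms by simp
  have "facet_index (m \<circ> \<sigma>) i j < num_facets n (m \<circ> \<sigma>)"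
    using assms by (intro facet_index_less) auto
  then have "facet_index (m \<circ> \<sigma>) i j < length ?cols"
    using length_concat_map_upt[of "\<lambda>i j. col L (facet_index m (\<sigma> i) j)" "m \<circ> \<sigma>" n] by simp
  moreover have "col L (facet_index m (\<sigma> i) j) \<in> carrier_vec (dim_row L)"
    by (rule col_dim)
  ultimately show ?thesis
    using nth by (simp add: permute_factors_def)
qed

text \<open>
  Permuting the coordinates of a point identifies the two products, and facets correspond to facets;
  hence facets that meet in one product meet in the other.
\<close>

lemma permute_factors_characteristic:
  assumes \<sigma>: "\<sigma> permutes {..<n}"
    and char: "characteristic_matrix d (num_facets n m) (product_facet n m) L"
  shows "characteristic_matrix d (num_facets n (m \<circ> \<sigma>)) (product_facet n (m \<circ> \<sigma>)) (permute_factors n m \<sigma> L)"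
  unfolding characteristic_matrix_def
proof (intro conjI allI impI)
  have L: "L \<in> carrier_mat d (num_facets n m)"
    using char by (simp add: characteristic_matrix_def)
  then show "permute_factors n m \<sigma> L \<in> carrier_mat d (num_facets n (m \<circ> \<sigma>))"
    by (rule permute_factors_carrier)
  have permuted_less: "\<sigma> i < n" if "i < n" for i
    using permutes_in_image[OF \<sigma>, of i] that by simp
  fix S assume S: "S \<subseteq> {..<num_facets n (m \<circ> \<sigma>)}"
    and meet: "(\<Inter>l\<in>S. product_facet n (m \<circ> \<sigma>) l) \<noteq> {}"
  then obtain p where p: "\<And>l. l \<in> S \<Longrightarrow> p \<in> product_facet n (m \<circ> \<sigma>) l" by blast
  obtain I J where IJ: "\<And>l. l \<in> S \<Longrightarrow>
      I l < n \<and> J l < m (\<sigma> (I l)) \<and> facet_index (m \<circ> \<sigma>) (I l) (J l) = l"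
    using facet_index_exhaust[of _ n "m \<circ> \<sigma>"] S by (metis comp_apply lessThan_iff subsetD)
  \<comment> \<open>\<open>\<tau>\<close> sends a facet of the permuted product to the corresponding facet of the original one.\<close>
  define \<tau> where "\<tau> l = facet_index m (\<sigma> (I l)) (J l)" for l
  have inj: "inj_on \<tau> S"
  proof (rule inj_onI)
    fix k l assume kl: "k \<in> S" "l \<in> S" "\<tau> k = \<tau> l"
    then have "\<sigma> (I k) = \<sigma> (I l)" "J k = J l"
      using IJ facet_index_eq_iff[of "J k" m "\<sigma> (I k)" "J l" "\<sigma> (I l)"] by (auto simp: \<tau>_def)
    then show "k = l" using IJ[OF kl(1)] IJ[OF kl(2)] permutes_inj[OF \<sigma>] by (metis injD)
  qed
  define q where "q = restrict (\<lambda>i. p (inv_into UNIV \<sigma> i)) {..<n}"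
  have "q \<in> product_facet n m (\<tau> l)" if l: "l \<in> S" for l
  proof -
    have bounds: "I l < n" "J l < (m \<circ> \<sigma>) (I l)" and eq: "facet_index (m \<circ> \<sigma>) (I l) (J l) = l"
      using IJ[OF l] by simp_all
    have pl: "p \<in> (\<Pi>\<^sub>E k\<in>{..<n}. polygon (m (\<sigma> k)))" "p (I l) \<in> polygon_side (m (\<sigma> (I l))) (J l)"
      using p[OF l] product_facet_iff[of "I l" n "J l" "m \<circ> \<sigma>" p, OF bounds, unfolded eq] by simp_all
    have "p (inv_into UNIV \<sigma> k) \<in> polygon (m k)" if "k < n" for k
    proof -
      have "inv_into UNIV \<sigma> k < n" using permutes_in_image[OF permutes_inv[OF \<sigma>], of k] that by simp
      then have "p (inv_into UNIV \<sigma> k) \<in> polygon (m (\<sigma> (inv_into UNIV \<sigma> k)))" using pl(1) by auto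
      then show ?thesis using permutes_inverses(1)[OF \<sigma>] by simp
    qed
    then show ?thesis
      using bounds pl permuted_less permutes_inverses(2)[OF \<sigma>]
      by (simp add: \<tau>_def product_facet_iff q_def)
  qed
  then have "(\<Inter>l\<in>\<tau> ` S. product_facet n m l) \<noteq> {}" by blast
  moreover have "\<tau> ` S \<subseteq> {..<num_facets n m}"
    using IJ permuted_less by (auto simp: \<tau>_def intro!: facet_index_less)
  ultimately have "lin_indpt_family d (col L) (\<tau> ` S)"
    using char unfolding characteristic_matrix_def by blast
  then show "lin_indpt_family d (col (permute_factors n m \<sigma> L)) S"
  proof (rule lin_indpt_family_reindex[OF _ inj])
    fix l assume "l \<in> S"
    then show "col (permute_factors n m \<sigma> L) l = col L (\<tau> l)"
      using IJ[of l] col_permute_factors[of "I l" n "J l" m \<sigma> L] by (simp add: \<tau>_def)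
  qed
qed

section \<open>Coordinates adapted to the factor weights\<close>

lemma factor_weight_index:
  assumes "i < n" "k < n" "j < m k"
  shows "factor_weight n m i $ facet_index m k j = of_bool (i = k)"
proof -
  have l: "facet_index m k j < num_facets n m" using assms by (intro facet_index_less)
  have "factor_weight n m i $ facet_index m k j =
      (\<Sum>h<m i. facet_vec n m i h $ facet_index m k j)"
    unfolding factor_weight_def
    by (rule index_finsum_vec) (use l in \<open>auto simp: facet_vec_def\<close>)
  also have "\<dots> = (\<Sum>h<m i. of_bool (i = k \<and> h = j))"
    using l assms by (intro sum.cong) (auto simp: facet_vec_def unit_vec_def facet_index_eq_iff)
  also have "\<dots> = of_bool (i = k)"
    using assms(3) by (cases "i = k") simp_all
  finally show ?thesis .
qed

text \<open>
  A vector of the row space is a combination of rows, and the coefficients \<open>x\<close> of the combination are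
  a linear functional with prescribed values on the columns.
\<close>

lemma row_space_dual_vector:
  assumes "L \<in> carrier_mat d N" and "w \<in> row_sp L"
  obtains x where "x \<in> carrier_vec d" "\<And>l. l < N \<Longrightarrow> col L l \<bullet> x = w $ l"
proof -
  obtain x where x: "x \<in> carrier_vec d" "L\<^sup>T *\<^sub>v x = w"
    using assms vec_space.row_space_eq[of L d "dim_col L"] by auto
  moreover have "col L l \<bullet> x = w $ l" if "l < N" for l
    using assms(1) that by (simp flip: x(2))
  ultimately show thesis using that by blast
qed

lemma sum_lessThan_double: "(\<Sum>s<2 * n. g s) = (\<Sum>i<n. g (2 * i) + g (2 * i + 1))"
  for g :: "nat \<Rightarrow> 'a::comm_monoid_add"
  by (induction n) (simp_all add: ac_simps)

text \<open>
  The coordinates \<open>2 * i\<close> and \<open>2 * i + 1\<close> belong to the factor \<open>i\<close>. The row \<open>2 * i\<close> is the weight of the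
  factor \<open>i\<close>, and at the vertex where sides 0 and 1 of every factor meet, the difference of the two
  columns of the factor \<open>k\<close> is the standard basis vector \<open>2 * k + 1\<close>.
\<close>

definition normalized :: "nat \<Rightarrow> (nat \<Rightarrow> nat) \<Rightarrow> bit mat \<Rightarrow> bool" where
  "normalized n m M \<longleftrightarrow> (\<forall>i<n. \<forall>k<n.
     (\<forall>j<m k. M $$ (2 * i, facet_index m k j) = of_bool (i = k)) \<and>
     M $$ (2 * i + 1, facet_index m k 0) = 0 \<and>
     M $$ (2 * i + 1, facet_index m k 1) = of_bool (i = k))"

text \<open>
  The new basis consists of \<open>\<lambda> (F k 0)\<close> and \<open>\<lambda> (F k 0) + \<lambda> (F k 1)\<close>. The functional that witnesses the
  weight of the factor \<open>i\<close> is 1 on the first of these vectors for \<open>k = i\<close> and 0 on all the others, so it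
  is the coordinate \<open>2 * i\<close>.
\<close>

lemma normal_form_exists:
  assumes m: "\<And>i. i < n \<Longrightarrow> 3 \<le> m i"
    and L: "product_characteristic_matrix n m L"
    and weights: "\<And>i. i < n \<Longrightarrow> factor_weight n m i \<in> row_sp L"
  obtains A where "A \<in> carrier_mat (2 * n) (2 * n)" "det A \<noteq> 0"
    "normalized n m (A * L)"
proof -
  let ?F = "facet_index m"
  have carrier: "L \<in> carrier_mat (2 * n) (num_facets n m)"
    using L by (simp add: characteristic_matrix_def)
  have less: "?F k j < num_facets n m" if "k < n" "j < m k" for k j
    using that by (rule facet_index_less)
  have less01: "?F k 0 < num_facets n m" "?F k 1 < num_facets n m" if "k < n" for k
    using less[OF that, of 0] less[OF that, of 1] m[OF that] by auto
  have colL: "col L l \<in> carrier_vec (2 * n)" for l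
    using carrier col_dim carrier_matD(1) by metis
  define v where "v s = (if even s then col L (?F (s div 2) 0)
    else col L (?F (s div 2) 0) + col L (?F (s div 2) 1))" for s
  have v_even: "v (2 * i) = col L (?F i 0)"
    and v_odd: "v (2 * i + 1) = col L (?F i 0) + col L (?F i 1)" for i
    by (simp_all add: v_def)
  have v: "v s \<in> carrier_vec (2 * n)" for s
    using colL by (auto simp: v_def)
  have parity: "\<exists>i<n. s = 2 * i \<or> s = 2 * i + 1" if "s < 2 * n" for s
    using that by presburger
  obtain A where A: "A \<in> carrier_mat (2 * n) (2 * n)" "det A \<noteq> 0"
    and Av: "\<And>s. s < 2 * n \<Longrightarrow> A *\<^sub>v v s = unit_vec (2 * n) s"
    and dual: "\<And>t x u. x \<in> carrier_vec (2 * n) \<Longrightarrow> u \<in> carrier_vec (2 * n) \<Longrightarrow> t < 2 * n \<Longrightarrow>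
      (\<And>s. s < 2 * n \<Longrightarrow> v s \<bullet> x = of_bool (s = t)) \<Longrightarrow> (A *\<^sub>v u) $ t = u \<bullet> x"
  proof (rule coordinates_in_basis[of "2 * n" v])
    fix c s assume zero: "\<And>r. r < 2 * n \<Longrightarrow> (\<Sum>s<2 * n. v s $ r * c s) = 0" and s: "s < 2 * n"
    \<comment> \<open>The same combination, rewritten with the columns of \<open>F i 0\<close> and \<open>F i 1\<close> themselves.\<close>
    define b where "b i j = (if j = 0 then c (2 * i) + c (2 * i + 1) else c (2 * i + 1))" for i and j :: nat
    have b: "b i j = 0" if "i < n" "j \<in> {0, 1}" for i j
    proof (rule meeting_facets_independent[OF L, of "\<lambda>_. {0, 1}" b])
      show "{0, 1} \<subseteq> {..<m i}" if "i < n" for i using m[OF that] by auto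
      show "(\<Inter>j\<in>{0, 1}. polygon_side (m i) j) \<noteq> {}" for i
        using consecutive_sides_meet[of "m i" 0] by simp
      fix r assume r: "r < 2 * n"
      have "(\<Sum>j\<in>{0, 1}. b i j * L $$ (r, ?F i j)) =
          v (2 * i) $ r * c (2 * i) + v (2 * i + 1) $ r * c (2 * i + 1)" if "i < n" for i
        unfolding v_even v_odd using r carrier less01[OF that]
        by (simp add: b_def algebra_simps)
      then have "(\<Sum>i<n. \<Sum>j\<in>{0, 1}. b i j * L $$ (r, ?F i j)) = (\<Sum>s<2 * n. v s $ r * c s)"
        by (simp add: sum_lessThan_double)
      then show "(\<Sum>i<n. \<Sum>j\<in>{0, 1}. b i j * L $$ (r, ?F i j)) = 0"
        using zero[OF r] by simp
    qed (use that in auto)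
    show "c s = 0"
      using parity[OF s] b[of _ 0] b[of _ 1] by (auto simp: b_def)
  qed (use v in auto)
  have AL: "(A * L) $$ (r, ?F k j) = (A *\<^sub>v col L (?F k j)) $ r"
    if "r < 2 * n" "k < n" "j < m k" for r k j
    using that A carrier less by simp
  have A0: "A *\<^sub>v col L (?F k 0) = unit_vec (2 * n) (2 * k)" if "k < n" for k
    using Av[of "2 * k"] that by (simp add: v_def)
  have A01: "A *\<^sub>v col L (?F k 0) + A *\<^sub>v col L (?F k 1) = unit_vec (2 * n) (2 * k + 1)"
    if "k < n" for k
    using Av[of "2 * k + 1"] that mult_add_distrib_mat_vec[OF A(1) colL colL] by (simp add: v_def)
  have odd_rows: "(A * L) $$ (2 * i + 1, ?F k 0) = 0"
      "(A * L) $$ (2 * i + 1, ?F k 1) = of_bool (i = k)" if ik: "i < n" "k < n" for i k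
  proof -
    show eq: "(A * L) $$ (2 * i + 1, ?F k 0) = 0"
      using AL[of "2 * i + 1" k 0] ik m[of k] A0[of k] by (simp add: unit_vec_def) presburger
    have "(A * L) $$ (2 * i + 1, ?F k 0) + (A * L) $$ (2 * i + 1, ?F k 1) =
        (A *\<^sub>v col L (?F k 0) + A *\<^sub>v col L (?F k 1)) $ (2 * i + 1)"
      using AL[of "2 * i + 1" k] ik m[of k] A by simp
    also have "\<dots> = of_bool (i = k)"
      unfolding A01[OF ik(2)] using ik by simp
    finally show "(A * L) $$ (2 * i + 1, ?F k 1) = of_bool (i = k)"
      unfolding eq by simp
  qed
  have even_rows: "(A * L) $$ (2 * i, ?F k j) = of_bool (i = k)"
    if ikj: "i < n" "k < n" "j < m k" for i k j
  proof -
    obtain x where x: "x \<in> carrier_vec (2 * n)"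
      and xL: "\<And>l. l < num_facets n m \<Longrightarrow> col L l \<bullet> x = factor_weight n m i $ l"
      using row_space_dual_vector[OF carrier weights[OF ikj(1)]] by blast
    have xF: "col L (?F k j) \<bullet> x = of_bool (i = k)" if "k < n" "j < m k" for k j
      using xL[OF less] that factor_weight_index ikj(1) by simp
    have "v s \<bullet> x = of_bool (s = 2 * i)" if s: "s < 2 * n" for s
    proof -
      obtain h where h: "h < n" "s = 2 * h \<or> s = 2 * h + 1" using parity[OF s] by blast
      have "v (2 * h) \<bullet> x = of_bool (i = h)"
        unfolding v_even using xF[of h 0] h m[of h] by simp
      moreover have "v (2 * h + 1) \<bullet> x = 0"
        unfolding v_odd using xF[of h 0] xF[of h 1] h m[of h]
        by (simp add: add_scalar_prod_distrib[OF colL colL x])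
      ultimately show ?thesis using h(2) by auto presburger
    qed
    then have "(A *\<^sub>v col L (?F k j)) $ (2 * i) = col L (?F k j) \<bullet> x"
      using dual[OF x colL] ikj by simp
    then show "(A * L) $$ (2 * i, ?F k j) = of_bool (i = k)"
      using AL[of "2 * i" k j] xF ikj by simp
  qed
  show thesis
    using that[OF A] even_rows odd_rows by (simp add: normalized_def)
qed

section \<open>Differences of columns at vertices\<close>

text \<open>
  Meeting sides stand for the two sides at a vertex of the polygon. The map assigns to each factor \<open>i\<close>
  the odd coordinate \<open>2 * i + 1\<close> of the difference of the two columns.
\<close>

definition side_differences :: "(nat \<Rightarrow> nat) \<Rightarrow> bit mat \<Rightarrow> nat \<Rightarrow> (nat \<Rightarrow> bit) set" where
  "side_differences m M k =
    {\<lambda>i. M $$ (2 * i + 1, facet_index m k a) + M $$ (2 * i + 1, facet_index m k b) |a b.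
       a < m k \<and> b < m k \<and> a \<noteq> b \<and> polygon_side (m k) a \<inter> polygon_side (m k) b \<noteq> {}}"

text \<open>
  Suppose that the chosen differences add up to a vector that vanishes on the factors in \<open>T\<close>. Each
  factor outside \<open>T\<close> contributes a standard basis vector as the difference of its sides 0 and 1;
  adding those of the factors where the sum is 1 gives zero. So the columns at a vertex are dependent.
\<close>

lemma side_differences_minors:
  assumes m: "\<And>i. i < n \<Longrightarrow> 3 \<le> m i"
    and M: "product_characteristic_matrix n m M" and norm: "normalized n m M"
    and T: "T \<subseteq> {..<n}" "T \<noteq> {}" and v: "\<And>k. k \<in> T \<Longrightarrow> v k \<in> side_differences m M k"
  shows "\<exists>i\<in>T. (\<Sum>k\<in>T. v k i) \<noteq> 0"
proof (rule ccontr)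
  assume "\<not> ?thesis"
  then have zero: "(\<Sum>k\<in>T. v k i) = 0" if "i \<in> T" for i using that by blast
  let ?F = "facet_index m"
  define good where "good k a b \<longleftrightarrow> a < m k \<and> b < m k \<and> a \<noteq> b \<and>
    polygon_side (m k) a \<inter> polygon_side (m k) b \<noteq> {} \<and>
    (k \<in> T \<longrightarrow> v k = (\<lambda>i. M $$ (2 * i + 1, ?F k a) + M $$ (2 * i + 1, ?F k b))) \<and>
    (k \<notin> T \<longrightarrow> a = 0 \<and> b = 1)" for k a b
  have "\<exists>a b. good k a b" if k: "k < n" for k
  proof (cases "k \<in> T")
    case True
    then show ?thesis using v[OF True] unfolding side_differences_def good_def by auto
  next
    case False
    then show ?thesis
      using m[OF k] consecutive_sides_meet[of "m k" 0] unfolding good_def by auto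
  qed
  then obtain a b where good: "\<And>k. k < n \<Longrightarrow> good k (a k) (b k)" by metis
  define w where "w i = (\<Sum>k\<in>T. v k i)" for i
  \<comment> \<open>The factors whose difference enters the vanishing sum.\<close>
  define S where "S = T \<union> {i \<in> {..<n} - T. w i = 1}"
  have S: "S \<subseteq> {..<n}" "T \<subseteq> S" using T by (auto simp: S_def)
  have finS: "finite S" using S finite_subset by blast
  have "(of_bool (k \<in> S) :: bit) = 0" if k: "k < n" "k \<in> T" for k
  proof (rule meeting_facets_independent[OF M, of "\<lambda>k. {a k, b k}" "\<lambda>k j. of_bool (k \<in> S)"])
    show "{a i, b i} \<subseteq> {..<m i}" "(\<Inter>j\<in>{a i, b i}. polygon_side (m i) j) \<noteq> {}" if "i < n" for i
      using good[OF that] by (auto simp: good_def)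
    fix r assume r: "r < 2 * n"
    define e where "e k = M $$ (r, ?F k (a k)) + M $$ (r, ?F k (b k))" for k
    have "(\<Sum>k<n. \<Sum>j\<in>{a k, b k}. of_bool (k \<in> S) * M $$ (r, ?F k j)) =
        (\<Sum>k<n. of_bool (k \<in> S) * e k)"
      using good by (intro sum.cong) (auto simp: good_def e_def)
    also have "\<dots> = sum e S"
      using S by (intro sum.mono_neutral_cong_right) auto
    also have "\<dots> = 0"
    proof -
      have "\<exists>i<n. r = 2 * i \<or> r = 2 * i + 1" using r by presburger
      then obtain i where i: "i < n" "r = 2 * i \<or> r = 2 * i + 1" by blast
      show ?thesis
      proof (cases "r = 2 * i")
        case True
        then have "e k = 0" if "k < n" for k
          using good[OF that] norm i(1) that by (simp add: e_def good_def normalized_def)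
        then show ?thesis using S by (intro sum.neutral) auto
      next
        case False
        then have r: "r = 2 * i + 1" using i by simp
        have "e k = v k i" if "k \<in> T" for k
          using good[of k] that T r by (auto simp: e_def good_def)
        moreover have "e k = of_bool (k = i)" if "k \<in> S - T" for k
          using good[of k] norm i(1) that S r
          by (auto simp: e_def good_def normalized_def)
        ultimately have "sum e S = w i + (\<Sum>k\<in>S - T. of_bool (k = i))"
          using sum.subset_diff[OF S(2) finS, of e] by (simp add: w_def add.commute)
        also have "(\<Sum>k\<in>S - T. of_bool (k = i)) = (of_bool (i \<in> S - T) :: bit)"
          unfolding of_bool_def using finS by simp
        also have "w i + \<dots> = 0"
          using i(1) zero[of i] by (cases "w i = 1") (auto simp: S_def w_def)
        finally show ?thesis .
      qed
    qed
    finally show "(\<Sum>k<n. \<Sum>j\<in>{a k, b k}. of_bool (k \<in> S) * M $$ (r, ?F k j)) = 0" .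
  qed (use that in auto)
  then show False using T S by force
qed

text \<open>
  The columns are \<open>(1, 0)\<close> or \<open>(1, 1)\<close>. Among three sides with a common point two would have equal
  columns, so at most two sides meet at a point, and the columns of two meeting sides are distinct and
  nonzero, hence independent.
\<close>

lemma polygon_characteristic_matrixI:
  assumes B: "B \<in> carrier_mat 2 k" and row0: "\<And>c. c < k \<Longrightarrow> B $$ (0, c) = 1"
    and row1: "\<And>a b. a < k \<Longrightarrow> b < k \<Longrightarrow> a \<noteq> b \<Longrightarrow>
      polygon_side k a \<inter> polygon_side k b \<noteq> {} \<Longrightarrow> B $$ (1, a) + B $$ (1, b) = 1"
  shows "polygon_characteristic_matrix k B"
  unfolding characteristic_matrix_def
proof (intro conjI allI impI B)
  fix S assume S: "S \<subseteq> {..<k}" and meet: "(\<Inter>l\<in>S. polygon_side k l) \<noteq> {}"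
  have differ: "B $$ (1, a) + B $$ (1, b) = 1" if "a \<in> S" "b \<in> S" "a \<noteq> b" for a b
    using that S meet by (intro row1) auto
  show "lin_indpt_family 2 (col B) S"
  proof (rule lin_indpt_familyI)
    show "finite S" using S finite_subset by blast
    show "col B l \<in> carrier_vec 2" for l
      using B col_dim carrier_matD(1) by metis
    fix T assume T: "T \<subseteq> S" "T \<noteq> {}" and zero: "\<And>r. r < 2 \<Longrightarrow> (\<Sum>l\<in>T. col B l $ r) = 0"
    have zero: "(\<Sum>l\<in>T. B $$ (r, l)) = 0" if "r < 2" for r
    proof -
      have "(\<Sum>l\<in>T. B $$ (r, l)) = (\<Sum>l\<in>T. col B l $ r)"
        using T S B that by (intro sum.cong) auto
      then show ?thesis using zero[OF that] by simp
    qed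
    obtain a where a: "a \<in> T" using T by auto
    have "T \<noteq> {a}" using zero[of 0] row0[of a] a T S by auto
    then obtain b where b: "b \<in> T" "b \<noteq> a" using a by auto
    have "T \<noteq> {a, b}" using zero[of 1] differ[of a b] a b T by auto
    then obtain c where c: "c \<in> T" "c \<noteq> a" "c \<noteq> b" using a b by auto
    have "B $$ (1, a) + B $$ (1, b) = 1" "B $$ (1, b) + B $$ (1, c) = 1" "B $$ (1, a) + B $$ (1, c) = 1"
      using a b c T differ by auto
    then show False
      by (cases "B $$ (1, a)"; cases "B $$ (1, b)"; cases "B $$ (1, c)") simp_all
  qed
qed

lemma permuted_rows_det:
  fixes A :: "'a::field mat"
  assumes A: "A \<in> carrier_mat d d" "det A \<noteq> 0" and \<rho>: "\<rho> ` {..<d} = {..<d}"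
  shows "det (mat d d (\<lambda>(r, s). A $$ (\<rho> r, s))) \<noteq> 0"
proof
  let ?P = "mat d d (\<lambda>(r, s). A $$ (\<rho> r, s))"
  assume "det ?P = 0"
  then obtain u where u: "u \<in> carrier_vec d" "u \<noteq> 0\<^sub>v d" "?P *\<^sub>v u = 0\<^sub>v d"
    using det_0_iff_vec_prod_zero[of ?P d] by auto
  have "A *\<^sub>v u = 0\<^sub>v d"
  proof (rule eq_vecI)
    fix t assume "t < dim_vec (0\<^sub>v d :: 'a vec)"
    then obtain r where r: "r < d" "t = \<rho> r" using \<rho> by (metis imageE index_zero_vec(2) lessThan_iff)
    then have "t < d" using \<rho> by auto
    have "(A *\<^sub>v u) $ t = (?P *\<^sub>v u) $ r"
      using r \<open>t < d\<close> A u(1) by (simp add: scalar_prod_def)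
    then show "(A *\<^sub>v u) $ t = 0\<^sub>v d $ t" using u(3) r \<open>t < d\<close> by simp
  qed (use A in simp)
  then show False using u A(2) det_0_iff_vec_prod_zero[OF A(1)] by metis
qed

section \<open>Block triangular form\<close>

theorem theorem6p4:
  fixes n :: nat and m :: "nat \<Rightarrow> nat" and L :: "bit mat"
  assumes "\<forall>i<n. 3 \<le> m i"
    and "product_characteristic_matrix n m L"
    and "factor_compatible n m L"
    and "\<forall>i<n. factor_weight n m i \<in> row_sp L"
  shows "\<exists>\<sigma> L'. \<sigma> permutes {..<n} \<and>
      product_characteristic_matrix n (m \<circ> \<sigma>) L' \<and>
      product_DJ_equivalent n (m \<circ> \<sigma>) (permute_factors n m \<sigma> L) L' \<and>
      block_lower_triangular n (m \<circ> \<sigma>) L' \<and>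
      (\<forall>i<n. polygon_characteristic_matrix (m (\<sigma> i)) (factor_block (m \<circ> \<sigma>) L' i i)) \<and>
      (\<forall>i<n. \<forall>c<m (\<sigma> i). factor_block (m \<circ> \<sigma>) L' i i $$ (0, c) = 1)"
proof -
  let ?F = "facet_index m"
  have m: "3 \<le> m i" if "i < n" for i using assms(1) that by blast
  have L: "L \<in> carrier_mat (2 * n) (num_facets n m)"
    using assms(2) by (simp add: characteristic_matrix_def)
  obtain A where A: "A \<in> carrier_mat (2 * n) (2 * n)" "det A \<noteq> 0" and norm: "normalized n m (A * L)"
    using normal_form_exists[OF m assms(2)] assms(4) by blast
  define M where "M = A * L"
  have M: "product_characteristic_matrix n m M"
    unfolding M_def by (rule characteristic_matrix_mult_left[OF assms(2) A])
  have even_rows: "M $$ (2 * i, ?F k j) = of_bool (i = k)" if "i < n" "k < n" "j < m k" for i k j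
    using norm that by (simp add: normalized_def M_def)
  note minors = side_differences_minors[OF m M norm[folded M_def]]
  obtain \<sigma> where \<sigma>: "\<sigma> permutes {..<n}"
    and triangular: "\<And>i j v. i < j \<Longrightarrow> j < n \<Longrightarrow> v \<in> side_differences m M (\<sigma> j) \<Longrightarrow> v (\<sigma> i) = 0"
    using triangular_permutation_exists[of n "side_differences m M"] minors by metis
  have \<sigma>_less: "\<sigma> i < n" if "i < n" for i
    using permutes_in_image[OF \<sigma>, of i] that by simp
  \<comment> \<open>The permutation of the rows that moves the pair of rows of the factor \<open>\<sigma> i\<close> to the place \<open>i\<close>.\<close>
  define \<rho> where "\<rho> r = 2 * \<sigma> (r div 2) + r mod 2" for r
  have \<rho>: "\<rho> ` {..<2 * n} = {..<2 * n}"
  proof (rule endo_inj_surj)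
    show "\<rho> ` {..<2 * n} \<subseteq> {..<2 * n}"
    proof (rule image_subsetI)
      fix r assume "r \<in> {..<2 * n}"
      then have "\<sigma> (r div 2) < n" by (intro \<sigma>_less) auto
      then show "\<rho> r \<in> {..<2 * n}" unfolding \<rho>_def lessThan_iff by linarith
    qed
    show "inj_on \<rho> {..<2 * n}"
    proof (rule inj_onI)
      fix r s assume "\<rho> r = \<rho> s"
      then have "\<sigma> (r div 2) = \<sigma> (s div 2)" "r mod 2 = s mod 2"
        unfolding \<rho>_def by presburger+
      then show "r = s"
        using permutes_inj[OF \<sigma>] by (metis div_mult_mod_eq injD)
    qed
  qed simp
  define A' where "A' = mat (2 * n) (2 * n) (\<lambda>(r, s). A $$ (\<rho> r, s))"
  have A': "A' \<in> carrier_mat (2 * n) (2 * n)" "det A' \<noteq> 0"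
    using permuted_rows_det[OF A \<rho>] by (simp_all add: A'_def)
  define L' where "L' = A' * permute_factors n m \<sigma> L"
  have entry: "L' $$ (2 * i + e, facet_index (m \<circ> \<sigma>) k c) = M $$ (2 * \<sigma> i + e, ?F (\<sigma> k) c)"
    if ik: "i < n" "e < 2" "k < n" "c < m (\<sigma> k)" for i e k c
  proof -
    have less: "facet_index (m \<circ> \<sigma>) k c < num_facets n (m \<circ> \<sigma>)" "?F (\<sigma> k) c < num_facets n m"
      using facet_index_less[of k n c "m \<circ> \<sigma>"] facet_index_less[of "\<sigma> k" n c m] ik \<sigma>_less[of k]
      by simp_all
    have r: "2 * i + e < 2 * n" "2 * \<sigma> i + e < 2 * n" using ik \<sigma>_less[of i] by linarith+
    have "L' $$ (2 * i + e, facet_index (m \<circ> \<sigma>) k c) =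
        row A' (2 * i + e) \<bullet> col L (?F (\<sigma> k) c)"
      using r less A'(1) permute_factors_carrier[OF L, of \<sigma>] col_permute_factors[of k n c m \<sigma> L] ik
      by (simp add: L'_def)
    also have "row A' (2 * i + e) = row A (2 * \<sigma> i + e)"
      using r A(1) ik by (intro eq_vecI) (auto simp: A'_def \<rho>_def)
    also have "\<dots> \<bullet> col L (?F (\<sigma> k) c) = M $$ (2 * \<sigma> i + e, ?F (\<sigma> k) c)"
      using r less A(1) L by (simp add: M_def)
    finally show ?thesis .
  qed
  have block: "factor_block (m \<circ> \<sigma>) L' i k $$ (e, c) = M $$ (2 * \<sigma> i + e, ?F (\<sigma> k) c)"
    if "i < n" "e < 2" "k < n" "c < m (\<sigma> k)" for i e k c
    using entry[OF that] that by (simp add: factor_block_def)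
  have row0: "factor_block (m \<circ> \<sigma>) L' i i $$ (0, c) = 1" if "i < n" "c < m (\<sigma> i)" for i c
    using block[of i 0 i c] even_rows[of "\<sigma> i" "\<sigma> i" c] that \<sigma>_less by simp
  have "product_characteristic_matrix n (m \<circ> \<sigma>) L'"
    unfolding L'_def
    by (rule characteristic_matrix_mult_left[OF permute_factors_characteristic[OF \<sigma> assms(2)] A'])
  moreover have "product_DJ_equivalent n (m \<circ> \<sigma>) (permute_factors n m \<sigma> L) L'"
    unfolding L'_def by (rule DJ_equivalent_mult_left[OF permute_factors_carrier[OF L] A'])
  moreover have "block_lower_triangular n (m \<circ> \<sigma>) L'"
    unfolding block_lower_triangular_def
  proof (intro allI impI)
    fix i j assume ij: "i < n" "j < n" "i < j"
    have neq: "\<sigma> i \<noteq> \<sigma> j" using ij permutes_inj[OF \<sigma>] by (metis injD less_irrefl)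
    \<comment> \<open>The entry is 0 at side 0 by normalization and does not change between consecutive sides,
      because the corresponding difference vanishes at \<open>\<sigma> i\<close>.\<close>
    have odd_row: "M $$ (2 * \<sigma> i + 1, ?F (\<sigma> j) c) = 0" if "c < m (\<sigma> j)" for c
      using that
    proof (induction c)
      case 0
      then show ?case
        using norm \<sigma>_less ij by (simp add: normalized_def M_def)
    next
      case (Suc c)
      let ?v = "\<lambda>h. M $$ (2 * h + 1, ?F (\<sigma> j) c) + M $$ (2 * h + 1, ?F (\<sigma> j) (Suc c))"
      have "?v \<in> side_differences m M (\<sigma> j)"
        unfolding side_differences_def
        using Suc.prems consecutive_sides_meet[of "m (\<sigma> j)" c]
        by (intro CollectI exI[of _ c] exI[of _ "Suc c"]) auto
      then have "?v (\<sigma> i) = 0" by (rule triangular[OF ij(3,2)])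
      then show ?case using Suc by simp
    qed
    show "factor_block (m \<circ> \<sigma>) L' i j = 0\<^sub>m 2 ((m \<circ> \<sigma>) j)"
    proof (rule eq_matI)
      fix e c assume "e < dim_row (0\<^sub>m 2 ((m \<circ> \<sigma>) j) :: bit mat)" "c < dim_col (0\<^sub>m 2 ((m \<circ> \<sigma>) j) :: bit mat)"
      then have ec: "e < 2" "c < m (\<sigma> j)" by simp_all
      then have "M $$ (2 * \<sigma> i + e, ?F (\<sigma> j) c) = 0"
        using even_rows[of "\<sigma> i" "\<sigma> j" c] odd_row[of c] neq \<sigma>_less ij by (cases "e = 0") (auto simp: less_2_cases_iff)
      then show "factor_block (m \<circ> \<sigma>) L' i j $$ (e, c) = 0\<^sub>m 2 ((m \<circ> \<sigma>) j) $$ (e, c)"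
        using block[of i e j c] ec ij by simp
    qed (simp_all add: factor_block_def)
  qed
  moreover have "polygon_characteristic_matrix (m (\<sigma> i)) (factor_block (m \<circ> \<sigma>) L' i i)" if i: "i < n" for i
  proof (rule polygon_characteristic_matrixI)
    show "factor_block (m \<circ> \<sigma>) L' i i \<in> carrier_mat 2 (m (\<sigma> i))"
      by (simp add: factor_block_def)
    show "factor_block (m \<circ> \<sigma>) L' i i $$ (0, c) = 1" if "c < m (\<sigma> i)" for c
      using row0 i that by blast
    fix a b assume ab: "a < m (\<sigma> i)" "b < m (\<sigma> i)" "a \<noteq> b"
      "polygon_side (m (\<sigma> i)) a \<inter> polygon_side (m (\<sigma> i)) b \<noteq> {}"
    let ?v = "\<lambda>h. M $$ (2 * h + 1, ?F (\<sigma> i) a) + M $$ (2 * h + 1, ?F (\<sigma> i) b)"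
    have "?v \<in> side_differences m M (\<sigma> i)"
      unfolding side_differences_def using ab by blast
    then have "?v (\<sigma> i) = 1"
      using minors[of "{\<sigma> i}" "\<lambda>_. ?v"] \<sigma>_less[OF i] by simp
    then show "factor_block (m \<circ> \<sigma>) L' i i $$ (1, a) + factor_block (m \<circ> \<sigma>) L' i i $$ (1, b) = 1"
      using block[of i 1 i] i ab by simp
  qed
  ultimately show ?thesis using \<sigma> row0 by blast
qed

end
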